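(* Let $G$ be a solvable locally compact group equipped with a proper, locally finite, left-invariant metric. Then the sparsification number of $G$ equals $1$, i.e. $a(G)=1$.
   Context: Metric Sparsification Property: a metric space $X$ has MS($c$), $0<c\le 1$, if there is a non-decreasing function $f:\mathbf{N}\to\mathbf{N}$ such that for all $m\in\mathbf{N}$ and every finite positive Borel measure $\mu$ on $X$ there is a Borel subset $\Omega=\bigsqcup_{i\in I}\Omega_i$ of $X$ with (i) $d(\Omega_i,\Omega_j)\ge m$ for all $i\ne j$ in $I$, where $d(A,B)=\inf\{d(a,b):a\in A,b\in B\}$; (ii) $\mathrm{Diam}(\Omega_i)\le f(m)$ for all $i\in I$; (iii) $\mu(\Omega)\ge c\,\mu(X)$. The sparsification number $a(X)$ is the supremum of all $c$ such that $X$ has MS($c$) (and $a(X)=0$ if there is no such $c$). Metrics on a locally compact group $G$: a metric is left-invariant if $d(gx,gy)=d(x,y)$; proper if every ball is relatively compact in $G$; locally finite (also called locally bounded) if every compact subset of $G$ has finite diameter. The metric need not induce the topology of $G$; Borel sets and Borel measures on $G$ refer to the locally compact topology of $G$. *)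

theory Defs
  imports "HOL-Analysis.Analysis" "HOL-Algebra.Solvable_Groups"
begin

section \<open>Metric sparsification\<close>

text \<open>
  The metric \<open>d\<close> is not assumed to induce the topology \<open>T\<close>: distances are measured by \<open>d\<close>,
  while measurability refers to the Borel sets of \<open>T\<close>. Values lie in \<^typ>\<open>ennreal\<close>, so that
  the distance to the empty set is \<open>\<infinity>\<close>, the diameter of the empty set is \<open>0\<close>, and
  unbounded sets have diameter \<open>\<infinity>\<close>.
\<close>

definition set_distance :: "('a \<Rightarrow> 'a \<Rightarrow> real) \<Rightarrow> 'a set \<Rightarrow> 'a set \<Rightarrow> ennreal" where
  "set_distance d A B = (INF a\<in>A. INF b\<in>B. ennreal (d a b))"

definition set_diameter :: "('a \<Rightarrow> 'a \<Rightarrow> real) \<Rightarrow> 'a set \<Rightarrow> ennreal" where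
  "set_diameter d A = (SUP a\<in>A. SUP b\<in>A. ennreal (d a b))"

definition borel_on :: "'a topology \<Rightarrow> 'a measure" where
  "borel_on T = sigma (topspace T) {U. openin T U}"

text \<open>
  The index set \<open>I\<close> can be taken inside the space: empty pieces may be dropped, and each
  nonempty piece can be indexed by one of its points. Only the union of the pieces is
  required to be Borel.
\<close>

definition metric_sparsification :: "'a topology \<Rightarrow> ('a \<Rightarrow> 'a \<Rightarrow> real) \<Rightarrow> real \<Rightarrow> bool" where
  "metric_sparsification T d c \<longleftrightarrow>
     0 < c \<and> c \<le> 1 \<and>
     (\<exists>f :: nat \<Rightarrow> nat. mono f \<and>
       (\<forall>m. \<forall>\<mu> :: 'a measure. sets \<mu> = sets (borel_on T) \<and> finite_measure \<mu> \<longrightarrow>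
         (\<exists>(I :: 'a set) (\<Omega> :: 'a \<Rightarrow> 'a set).
            disjoint_family_on \<Omega> I \<and>
            (\<Union>i\<in>I. \<Omega> i) \<in> sets (borel_on T) \<and>
            (\<forall>i\<in>I. \<forall>j\<in>I. i \<noteq> j \<longrightarrow> of_nat m \<le> set_distance d (\<Omega> i) (\<Omega> j)) \<and>
            (\<forall>i\<in>I. set_diameter d (\<Omega> i) \<le> of_nat (f m)) \<and>
            c * measure \<mu> (space \<mu>) \<le> measure \<mu> (\<Union>i\<in>I. \<Omega> i))))"

definition sparsification_number :: "'a topology \<Rightarrow> ('a \<Rightarrow> 'a \<Rightarrow> real) \<Rightarrow> real" where
  "sparsification_number T d =
     (if \<exists>c. metric_sparsification T d c then Sup {c. metric_sparsification T d c} else 0)"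


section \<open>Locally compact groups and their metrics\<close>

text \<open>As usual, locally compact groups are Hausdorff.\<close>

locale locally_compact_group = group G
  for G :: "('a, 'b) monoid_scheme" (structure) and T :: "'a topology" +
  assumes topspace_eq_carrier: "topspace T = carrier G"
    and continuous_mult: "continuous_map (prod_topology T T) T (\<lambda>(x, y). x \<otimes> y)"
    and continuous_inv: "continuous_map T T (\<lambda>x. inv x)"
    and Hausdorff: "Hausdorff_space T"
    and locally_compact: "locally_compact_space T"

definition left_invariant :: "('a, 'b) monoid_scheme \<Rightarrow> ('a \<Rightarrow> 'a \<Rightarrow> real) \<Rightarrow> bool" where
  "left_invariant G d \<longleftrightarrow>
     (\<forall>g\<in>carrier G. \<forall>x\<in>carrier G. \<forall>y\<in>carrier G. d (g \<otimes>\<^bsub>G\<^esub> x) (g \<otimes>\<^bsub>G\<^esub> y) = d x y)"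

definition proper_metric :: "'a topology \<Rightarrow> ('a \<Rightarrow> 'a \<Rightarrow> real) \<Rightarrow> bool" where
  "proper_metric T d \<longleftrightarrow>
     (\<forall>x\<in>topspace T. \<forall>r. compactin T (T closure_of (Metric_space.mball (topspace T) d x r)))"

definition locally_finite_metric :: "'a topology \<Rightarrow> ('a \<Rightarrow> 'a \<Rightarrow> real) \<Rightarrow> bool" where
  "locally_finite_metric T d \<longleftrightarrow> (\<forall>K. compactin T K \<longrightarrow> set_diameter d K < \<infinity>)"

end

theory Submission
  imports Defs
begin

text \<open>
  Cutting the group into countably many Borel pieces of bounded diameter replaces a finite Borel
  measure, up to a small loss of mass, by a finitely supported weight. What remains is a statement
  about the group with its left-invariant metric and no topology, apart from one consequence of
  properness: for some \<open>r\<^sub>0\<close>, every ball is covered by finitely many balls of radius \<open>r\<^sub>0\<close>. It is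
  proved along the solvable series.

  Let \<open>N\<close> be normal in \<open>H\<close> with abelian quotient and let \<open>m\<close> be the required separation. Cosets of
  the subgroup generated by \<open>N\<close> and the elements of \<open>H\<close> of length at most \<open>m\<close> are \<open>m\<close>-separated, and
  this subgroup lies in a bounded neighbourhood of one generated by \<open>N\<close> and finitely many elements.
  So it suffices to adjoin a single element \<open>s\<close>. Either short elements meet only finitely many
  layers \<open>N s^j\<close>, and one cuts into slabs of consecutive layers, averaging over the
  position of the cuts; or the layers met by short elements are syndetic, and the whole group stays
  at bounded distance from \<open>N\<close>.
\<close>

section \<open>Sparsification of finitely supported weights\<close>

text \<open>The pieces of \<open>\<Omega>\<close> are its classes under \<open>E\<close>.\<close>

definition sparsifies :: "('a \<Rightarrow> 'a \<Rightarrow> real) \<Rightarrow> real \<Rightarrow> real \<Rightarrow> real \<Rightarrow> 'a set \<Rightarrow> bool" where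
  "sparsifies d m \<epsilon> R S \<longleftrightarrow>
     (\<forall>F w. finite F \<and> F \<subseteq> S \<and> (\<forall>x. 0 \<le> w x) \<longrightarrow>
       (\<exists>\<Omega> E. \<Omega> \<subseteq> F \<and> equivp E \<and>
          (\<forall>x\<in>\<Omega>. \<forall>y\<in>\<Omega>. (E x y \<longrightarrow> d x y \<le> R) \<and> (\<not> E x y \<longrightarrow> m \<le> d x y)) \<and>
          (1 - \<epsilon>) * sum w F \<le> sum w \<Omega>))"

text \<open>\<open>R\<close> is chosen before the weight, which later yields the function of the
  sparsification property. The separation \<open>m\<close> is real so that thickening can enlarge it
  by \<open>2 * r\<close>.\<close>

definition sparsifiable :: "('a \<Rightarrow> 'a \<Rightarrow> real) \<Rightarrow> 'a set \<Rightarrow> bool" where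
  "sparsifiable d S \<longleftrightarrow> (\<forall>m. \<forall>\<epsilon>>0. \<exists>R. sparsifies d m \<epsilon> R S)"

lemma sparsifiesE:
  assumes "sparsifies d m \<epsilon> R S" "finite F" "F \<subseteq> S" "\<And>x. 0 \<le> w x"
  obtains \<Omega> E where "\<Omega> \<subseteq> F" "equivp E"
    "\<And>x y. x \<in> \<Omega> \<Longrightarrow> y \<in> \<Omega> \<Longrightarrow> E x y \<Longrightarrow> d x y \<le> R"
    "\<And>x y. x \<in> \<Omega> \<Longrightarrow> y \<in> \<Omega> \<Longrightarrow> \<not> E x y \<Longrightarrow> m \<le> d x y"
    "(1 - \<epsilon>) * sum w F \<le> sum w \<Omega>"
  using assms unfolding sparsifies_def by (metis (no_types, lifting))

lemma sparsifiesI: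
  assumes "\<And>F w. finite F \<Longrightarrow> F \<subseteq> S \<Longrightarrow> (\<And>x. 0 \<le> w x) \<Longrightarrow>
       (\<exists>\<Omega> E. \<Omega> \<subseteq> F \<and> equivp E \<and>
          (\<forall>x\<in>\<Omega>. \<forall>y\<in>\<Omega>. (E x y \<longrightarrow> d x y \<le> R) \<and> (\<not> E x y \<longrightarrow> m \<le> d x y)) \<and>
          (1 - \<epsilon>) * sum w F \<le> sum w \<Omega>)"
  shows "sparsifies d m \<epsilon> R S"
  using assms unfolding sparsifies_def by blast

lemma sparsifies_subset:
  assumes "sparsifies d m \<epsilon> R S" "S' \<subseteq> S"
  shows "sparsifies d m \<epsilon> R S'"
proof (rule sparsifiesI)
  fix F and w :: "'a \<Rightarrow> real"
  assume "finite F" "F \<subseteq> S'" "\<And>x. 0 \<le> w x"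
  moreover from this have "F \<subseteq> S"
    using assms(2) by blast
  ultimately show "\<exists>\<Omega> E. \<Omega> \<subseteq> F \<and> equivp E \<and>
          (\<forall>x\<in>\<Omega>. \<forall>y\<in>\<Omega>. (E x y \<longrightarrow> d x y \<le> R) \<and> (\<not> E x y \<longrightarrow> m \<le> d x y)) \<and>
          (1 - \<epsilon>) * sum w F \<le> sum w \<Omega>"
    using assms(1) unfolding sparsifies_def by blast
qed

lemma sparsifiable_subset:
  assumes "sparsifiable d S" "S' \<subseteq> S"
  shows "sparsifiable d S'"
  using assms(1) sparsifies_subset[OF _ assms(2)] unfolding sparsifiable_def by metis

lemma sparsifies_singleton:
  assumes "d x x = 0" "0 \<le> \<epsilon>"
  shows "sparsifies d m \<epsilon> 0 {x}"
proof (rule sparsifiesI)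
  fix F and w :: "'a \<Rightarrow> real"
  assume "finite F" "F \<subseteq> {x}" and w: "\<And>x. 0 \<le> w x"
  then show "\<exists>\<Omega> E. \<Omega> \<subseteq> F \<and> equivp E \<and>
          (\<forall>x\<in>\<Omega>. \<forall>y\<in>\<Omega>. (E x y \<longrightarrow> d x y \<le> 0) \<and> (\<not> E x y \<longrightarrow> m \<le> d x y)) \<and>
          (1 - \<epsilon>) * sum w F \<le> sum w \<Omega>"
    using assms sum_nonneg[of F w]
    by (intro exI[of _ F] exI[of _ "\<lambda>_ _. True"])
      (auto intro!: equivpI reflpI sympI transpI simp: algebra_simps subset_singleton_iff)
qed

text \<open>Push the weight forward along \<open>p\<close>, sparsify the image and pull the pieces
  back; \<open>p\<close> need not be injective.\<close>

lemma sparsifies_pullback: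
  assumes S: "sparsifies d m' \<epsilon> R' S"
    and p: "\<And>x. x \<in> S' \<Longrightarrow> p x \<in> S"
    and R: "\<And>x y. x \<in> S' \<Longrightarrow> y \<in> S' \<Longrightarrow> d (p x) (p y) \<le> R' \<Longrightarrow> d x y \<le> R"
    and m: "\<And>x y. x \<in> S' \<Longrightarrow> y \<in> S' \<Longrightarrow> m' \<le> d (p x) (p y) \<Longrightarrow> m \<le> d x y"
  shows "sparsifies d m \<epsilon> R S'"
proof (rule sparsifiesI)
  fix F and w :: "'a \<Rightarrow> real"
  assume F: "finite F" "F \<subseteq> S'" and w: "\<And>x. 0 \<le> w x"
  define v where "v y = sum w {x\<in>F. p x = y}" for y
  have v: "0 \<le> v y" for y
    unfolding v_def using w by (simp add: sum_nonneg)
  have sum_v: "sum v A = sum w {x\<in>F. p x \<in> A}" if "A \<subseteq> p ` F" for A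
  proof -
    have "finite A"
      using that F(1) finite_surj by blast
    then have "(\<Sum>y\<in>A. sum w {x \<in> {x\<in>F. p x \<in> A}. p x = y}) = sum w {x\<in>F. p x \<in> A}"
      using F(1) by (intro sum.group) auto
    moreover have "{x \<in> {x\<in>F. p x \<in> A}. p x = y} = {x\<in>F. p x = y}" if "y \<in> A" for y
      using that by auto
    ultimately show ?thesis
      unfolding v_def by simp
  qed
  have "finite (p ` F)" "p ` F \<subseteq> S"
    using F p by auto
  from sparsifiesE[OF S this, of v, OF v]
  obtain \<Omega> E where O: "\<Omega> \<subseteq> p ` F" "equivp E"
    "\<And>x y. x \<in> \<Omega> \<Longrightarrow> y \<in> \<Omega> \<Longrightarrow> E x y \<Longrightarrow> d x y \<le> R'"
    "\<And>x y. x \<in> \<Omega> \<Longrightarrow> y \<in> \<Omega> \<Longrightarrow> \<not> E x y \<Longrightarrow> m' \<le> d x y"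
    "(1 - \<epsilon>) * sum v (p ` F) \<le> sum v \<Omega>"
    by (metis (no_types, lifting))
  have "{x \<in> F. p x \<in> p ` F} = F"
    by auto
  then have "(1 - \<epsilon>) * sum w F \<le> sum w {x\<in>F. p x \<in> \<Omega>}"
    using O(5) sum_v[OF O(1)] sum_v[of "p ` F"] by simp
  moreover have "equivp (\<lambda>x y. E (p x) (p y))"
    using O(2) unfolding equivp_reflp_symp_transp reflp_def symp_def transp_def by blast
  ultimately show "\<exists>\<Omega> E. \<Omega> \<subseteq> F \<and> equivp E \<and>
          (\<forall>x\<in>\<Omega>. \<forall>y\<in>\<Omega>. (E x y \<longrightarrow> d x y \<le> R) \<and> (\<not> E x y \<longrightarrow> m \<le> d x y)) \<and>
          (1 - \<epsilon>) * sum w F \<le> sum w \<Omega>"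
    using O(3,4) R m F(2)
    by (intro exI[of _ "{x\<in>F. p x \<in> \<Omega>}"] exI[of _ "\<lambda>x y. E (p x) (p y)"]) (auto simp: subset_iff)
qed

text \<open>Different fibres of \<open>h\<close> are already separated, so they can be sparsified
  independently with a common \<open>R\<close> and the results united.\<close>

lemma sparsifies_glue:
  fixes h :: "'a \<Rightarrow> 'b"
  assumes fib: "\<And>j. sparsifies d m \<epsilon> R {x\<in>S. h x = j}"
    and sep: "\<And>x y. x \<in> S \<Longrightarrow> y \<in> S \<Longrightarrow> h x \<noteq> h y \<Longrightarrow> m \<le> d x y"
  shows "sparsifies d m \<epsilon> R S"
proof (rule sparsifiesI)
  fix F and w :: "'a \<Rightarrow> real"
  assume F: "finite F" "F \<subseteq> S" and w: "\<And>x. 0 \<le> w x"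
  define Fj where "Fj j = {x\<in>F. h x = j}" for j
  have "\<exists>\<Omega> E. \<Omega> \<subseteq> Fj j \<and> equivp E \<and>
          (\<forall>x\<in>\<Omega>. \<forall>y\<in>\<Omega>. (E x y \<longrightarrow> d x y \<le> R) \<and> (\<not> E x y \<longrightarrow> m \<le> d x y)) \<and>
          (1 - \<epsilon>) * sum w (Fj j) \<le> sum w \<Omega>" for j
  proof -
    have "finite (Fj j)" "Fj j \<subseteq> {x\<in>S. h x = j}"
      using F by (auto simp: Fj_def)
    then show ?thesis
      using fib[of j] w unfolding sparsifies_def by blast
  qed
  then obtain \<Omega> E where O: "\<And>j. \<Omega> j \<subseteq> Fj j" "\<And>j. equivp (E j)"
    "\<And>j x y. x \<in> \<Omega> j \<Longrightarrow> y \<in> \<Omega> j \<Longrightarrow> (E j x y \<longrightarrow> d x y \<le> R) \<and> (\<not> E j x y \<longrightarrow> m \<le> d x y)"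
    "\<And>j. (1 - \<epsilon>) * sum w (Fj j) \<le> sum w (\<Omega> j)"
    by metis
  have h\<Omega>: "x \<in> F \<and> h x = j" if "x \<in> \<Omega> j" for x j
    using O(1) that by (auto simp: Fj_def subset_iff)
  define U where "U = (\<Union>j\<in>h ` F. \<Omega> j)"
  have U: "x \<in> U \<longleftrightarrow> x \<in> F \<and> x \<in> \<Omega> (h x)" for x
    using h\<Omega> unfolding U_def by (metis UN_iff imageE imageI)
  have fin: "finite (\<Omega> j)" for j
    using O(1)[of j] F(1) by (auto simp: Fj_def intro: finite_subset)
  have "sum w F = (\<Sum>j\<in>h ` F. sum w (Fj j))"
    using sum.group[of F "h ` F" h w] F(1) by (simp add: Fj_def)
  moreover have "sum w U = (\<Sum>j\<in>h ` F. sum w (\<Omega> j))"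
    unfolding U_def using F(1) fin h\<Omega> by (intro sum.UNION_disjoint) (auto dest: h\<Omega>)
  ultimately have "(1 - \<epsilon>) * sum w F \<le> sum w U"
    using O(4) by (simp add: sum_distrib_left sum_mono)
  moreover have "equivp (\<lambda>x y. h x = h y \<and> E (h x) x y)"
    using O(2) unfolding equivp_reflp_symp_transp reflp_def symp_def transp_def by metis
  moreover have "(h x = h y \<and> E (h x) x y \<longrightarrow> d x y \<le> R) \<and> (\<not> (h x = h y \<and> E (h x) x y) \<longrightarrow> m \<le> d x y)"
    if "x \<in> U" "y \<in> U" for x y
    using that O(3)[of x "h x" y] sep[of x y] F(2) by (cases "h x = h y") (auto simp: U)
  moreover have "U \<subseteq> F"
    by (auto simp: U)
  ultimately show "\<exists>\<Omega> E. \<Omega> \<subseteq> F \<and> equivp E \<and>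
          (\<forall>x\<in>\<Omega>. \<forall>y\<in>\<Omega>. (E x y \<longrightarrow> d x y \<le> R) \<and> (\<not> E x y \<longrightarrow> m \<le> d x y)) \<and>
          (1 - \<epsilon>) * sum w F \<le> sum w \<Omega>"
    by (intro exI[of _ U] exI[of _ "\<lambda>x y. h x = h y \<and> E (h x) x y"]) blast
qed

text \<open>Double counting: since each point is missed by at most a \<open>\<delta>\<close> share
  of the indices, some \<open>t\<close> misses at most a \<open>\<delta>\<close> share of the
  weight. Sparsifying \<open>S t\<close> then loses at most a further \<open>\<epsilon>\<close>
  share.\<close>

lemma sparsifies_average:
  fixes S :: "'b \<Rightarrow> 'a set"
  assumes T: "finite T" "T \<noteq> {}"
    and S: "\<And>t. t \<in> T \<Longrightarrow> sparsifies d m \<epsilon> R (S t)"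
    and few: "\<And>x. x \<in> X \<Longrightarrow> real (card {t\<in>T. x \<notin> S t}) \<le> \<delta> * real (card T)"
    and "0 \<le> \<epsilon>"
  shows "sparsifies d m (\<epsilon> + \<delta>) R X"
proof (rule sparsifiesI)
  fix F and w :: "'a \<Rightarrow> real"
  assume F: "finite F" "F \<subseteq> X" and w: "\<And>x. 0 \<le> w x"
  have "\<exists>t\<in>T. sum w {x\<in>F. x \<notin> S t} \<le> \<delta> * sum w F"
  proof (rule ccontr)
    assume "\<not> ?thesis"
    then have "(\<Sum>t\<in>T. \<delta> * sum w F) < (\<Sum>t\<in>T. sum w {x\<in>F. x \<notin> S t})"
      using T by (intro sum_strict_mono) auto
    also have "\<dots> = (\<Sum>x\<in>F. \<Sum>t | t \<in> T \<and> x \<notin> S t. w x)"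
      by (rule sum.swap_restrict[OF T(1) F(1)])
    also have "\<dots> = (\<Sum>x\<in>F. w x * real (card {t\<in>T. x \<notin> S t}))"
      by (simp add: mult.commute)
    also have "\<dots> \<le> (\<Sum>x\<in>F. w x * (\<delta> * real (card T)))"
      using few F(2) w by (intro sum_mono mult_left_mono) auto
    also have "\<dots> = (\<Sum>t\<in>T. \<delta> * sum w F)"
      by (simp add: sum_distrib_left sum_distrib_right mult_ac)
    finally show False by simp
  qed
  then obtain t where t: "t \<in> T" "sum w {x\<in>F. x \<notin> S t} \<le> \<delta> * sum w F"
    by blast
  have "finite {x\<in>F. x \<in> S t}" "{x\<in>F. x \<in> S t} \<subseteq> S t"
    using F by auto
  from sparsifiesE[OF S[OF t(1)] this, of w, OF w]
  obtain \<Omega> E where O: "\<Omega> \<subseteq> {x\<in>F. x \<in> S t}" "equivp E"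
    "\<forall>x\<in>\<Omega>. \<forall>y\<in>\<Omega>. (E x y \<longrightarrow> d x y \<le> R) \<and> (\<not> E x y \<longrightarrow> m \<le> d x y)"
    "(1 - \<epsilon>) * sum w {x\<in>F. x \<in> S t} \<le> sum w \<Omega>"
    by (metis (no_types, lifting))
  have "sum w F = sum w {x\<in>F. x \<in> S t} + sum w {x\<in>F. x \<notin> S t}"
    using F(1) by (subst sum.union_disjoint[symmetric]) (auto intro: sum.cong)
  moreover have "sum w {x\<in>F. x \<in> S t} \<le> sum w F"
    using F(1) w by (intro sum_mono2) auto
  then have "\<epsilon> * sum w {x\<in>F. x \<in> S t} \<le> \<epsilon> * sum w F"
    using \<open>0 \<le> \<epsilon>\<close> by (rule mult_left_mono)
  ultimately have "(1 - (\<epsilon> + \<delta>)) * sum w F \<le> sum w \<Omega>"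
    using O(4) t(2) unfolding left_diff_distrib distrib_right by linarith
  then show "\<exists>\<Omega> E. \<Omega> \<subseteq> F \<and> equivp E \<and>
          (\<forall>x\<in>\<Omega>. \<forall>y\<in>\<Omega>. (E x y \<longrightarrow> d x y \<le> R) \<and> (\<not> E x y \<longrightarrow> m \<le> d x y)) \<and>
          (1 - (\<epsilon> + \<delta>)) * sum w F \<le> sum w \<Omega>"
    using O by (intro exI[of _ \<Omega>] exI[of _ E]) auto
qed

text \<open>Moving each point to a nearby point of \<open>S\<close> changes distances by at most
  \<open>2 * r\<close>; hence the stronger separation asked of \<open>S\<close> and the larger
  diameter bound obtained.\<close>

lemma sparsifies_thicken:
  assumes "Metric_space M d" "S \<subseteq> M" "S' \<subseteq> M"
    and S: "sparsifies d (m + 2 * r) \<epsilon> R S"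
    and near: "\<And>x. x \<in> S' \<Longrightarrow> \<exists>y\<in>S. d x y \<le> r"
  shows "sparsifies d m \<epsilon> (R + 2 * r) S'"
proof -
  interpret Metric_space M d by fact
  obtain p where p: "\<And>x. x \<in> S' \<Longrightarrow> p x \<in> S \<and> d x (p x) \<le> r"
    using near by metis
  have le: "d x y \<le> d (p x) (p y) + 2 * r" "d (p x) (p y) \<le> d x y + 2 * r"
    if "x \<in> S'" "y \<in> S'" for x y
    using p[OF that(1)] p[OF that(2)] that assms(2,3)
      triangle[of x "p x" y] triangle[of "p x" "p y" y] triangle[of "p x" x "p y"] triangle[of x y "p y"]
      commute[of "p y" y] commute[of "p x" x]
    by (auto simp: subset_iff)
  show ?thesis
    by (rule sparsifies_pullback[OF S, where p = p]) (use p le in fastforce)+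
qed

lemma sparsifiable_thicken:
  assumes "Metric_space M d" "S \<subseteq> M" "S' \<subseteq> M" "sparsifiable d S"
    and "\<And>x. x \<in> S' \<Longrightarrow> \<exists>y\<in>S. d x y \<le> r"
  shows "sparsifiable d S'"
  unfolding sparsifiable_def
proof (intro allI impI)
  fix m \<epsilon> :: real assume "0 < \<epsilon>"
  then obtain R where "sparsifies d (m + 2 * r) \<epsilon> R S"
    using assms(4) unfolding sparsifiable_def by blast
  then show "\<exists>R. sparsifies d m \<epsilon> R S'"
    using sparsifies_thicken[OF assms(1-3) _ assms(5)] by blast
qed

section \<open>Approximate subgroups of the integers\<close>

text \<open>Infinitude and symmetry give some \<open>c\<close> in \<open>C\<close> beyond every
  correction in \<open>Z\<close>. Adding \<open>c\<close> and correcting then always advances, by a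
  bounded amount, so \<open>C\<close> has bounded gaps on the nonnegative side; negation handles the
  other side.\<close>

lemma infinite_approximate_subgroup_int_syndetic:
  fixes C Z :: "int set"
  assumes C: "infinite C" "0 \<in> C" "\<And>x. x \<in> C \<Longrightarrow> - x \<in> C"
    and Z: "finite Z" "\<And>x y. x \<in> C \<Longrightarrow> y \<in> C \<Longrightarrow> \<exists>z\<in>Z. x + y - z \<in> C"
  shows "\<exists>B. \<forall>x. \<exists>y\<in>C. \<bar>x - y\<bar> \<le> B"
proof -
  obtain f where f: "0 \<le> f" "\<And>z. z \<in> Z \<Longrightarrow> \<bar>z\<bar> \<le> f"
  proof
    show "0 \<le> (\<Sum>z\<in>Z. \<bar>z\<bar>)"
      by (simp add: sum_nonneg)
    show "\<bar>z\<bar> \<le> (\<Sum>z\<in>Z. \<bar>z\<bar>)" if "z \<in> Z" for z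
      using member_le_sum[OF that, of abs] Z(1) by simp
  qed
  obtain c where c: "c \<in> C" "f < c"
  proof -
    have "\<not> C \<subseteq> {-f..f}"
      using C(1) finite_subset by blast
    then obtain c where "c \<in> C" "f < \<bar>c\<bar>"
      by fastforce
    then show ?thesis
      using that[of c] that[of "- c"] C(3) by (cases "0 \<le> c") auto
  qed
  \<comment> \<open>From \<open>y \<in> C\<close> one reaches a larger element of \<open>C\<close> within \<open>c + f\<close> by correcting \<open>y + c\<close>.\<close>
  have nonneg: "\<exists>y\<in>C. y \<le> int n \<and> int n - y < c + f" for n
  proof (induction n)
    case 0
    then show ?case
      using C(2) c f(1) by force
  next
    case (Suc n)
    then obtain y where y: "y \<in> C" "y \<le> int n" "int n - y < c + f"
      by blast
    show ?case
    proof (cases "int (Suc n) - y < c + f")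
      case True
      then show ?thesis
        using y by (intro bexI[of _ y]) auto
    next
      case False
      \<comment> \<open>The gap has just reached \<open>c + f\<close>; replacing \<open>y\<close> by
        \<open>y + c - z\<close> leaves the gap \<open>f + z\<close>, which is at most
        \<open>2 * f\<close> and hence below \<open>c + f\<close>.\<close>
      then have n: "int (Suc n) = y + c + f"
        using y by simp
      obtain z where "z \<in> Z" "y + c - z \<in> C"
        using Z(2)[OF y(1) c(1)] by blast
      moreover from this have "\<bar>z\<bar> \<le> f"
        using f(2) by blast
      ultimately show ?thesis
        using n c(2) by (intro bexI[of _ "y + c - z"]) auto
    qed
  qed
  have "\<exists>y\<in>C. \<bar>x - y\<bar> \<le> c + f" for x
  proof (cases "0 \<le> x")
    case True
    then show ?thesis
      using nonneg[of "nat x"] by force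
  next
    case False
    then obtain y where "y \<in> C" "y \<le> - x" "- x - y < c + f"
      using nonneg[of "nat (- x)"] by auto
    then show ?thesis
      using C(3) by (intro bexI[of _ "- y"]) auto
  qed
  then show ?thesis
    by blast
qed

section \<open>Groups with a left-invariant metric\<close>

text \<open>No topology remains here. The radius \<open>r\<^sub>0\<close> does not depend on
  \<open>R\<close>; with \<open>r\<^sub>0 = 0\<close> the axiom \<open>cover\<close> would say that
  balls are finite, and a positive scale admits groups that are not discrete.\<close>

locale coarsely_proper_group = group G + Metric_space "carrier G" d
  for G :: "('a, 'b) monoid_scheme" (structure) and d +
  fixes r\<^sub>0 :: real
  assumes left_inv: "\<And>g x y. g \<in> carrier G \<Longrightarrow> x \<in> carrier G \<Longrightarrow> y \<in> carrier G \<Longrightarrow>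
      d (g \<otimes> x) (g \<otimes> y) = d x y"
    and cover: "\<And>R. \<exists>S. finite S \<and> S \<subseteq> carrier G \<and>
      (\<forall>x\<in>carrier G. d \<one> x \<le> R \<longrightarrow> (\<exists>s\<in>S. d s x \<le> r\<^sub>0))"
begin

lemma dist_eq_length:
  assumes "x \<in> carrier G" "y \<in> carrier G"
  shows "d x y = d \<one> (inv x \<otimes> y)"
  using left_inv[of "inv x" x y] assms by simp

lemma length_mult:
  assumes "x \<in> carrier G" "y \<in> carrier G"
  shows "d \<one> (x \<otimes> y) \<le> d \<one> x + d \<one> y"
  using triangle[of \<one> x "x \<otimes> y"] left_inv[of x \<one> y] assms by simp

lemma length_inv:
  assumes "x \<in> carrier G"
  shows "d \<one> (inv x) = d \<one> x"
  using dist_eq_length[of x \<one>] commute[of x \<one>] assms by simp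

lemma r0_nonneg: "0 \<le> r\<^sub>0"
proof -
  obtain s where "d s \<one> \<le> r\<^sub>0"
    using cover[of 0] by force
  then show ?thesis
    using nonneg[of s \<one>] by linarith
qed

lemma sparsifies_translate:
  assumes "sparsifies d m \<epsilon> R S" "S \<subseteq> carrier G" "g \<in> carrier G"
  shows "sparsifies d m \<epsilon> R {x\<in>carrier G. inv g \<otimes> x \<in> S}"
  by (rule sparsifies_pullback[OF assms(1), where p = "\<lambda>x. inv g \<otimes> x"])
    (use assms(3) in \<open>auto simp: left_inv\<close>)

text \<open>Each useful centre is replaced by a point of \<open>H\<close> within
  \<open>r\<^sub>0\<close> of it, which doubles the radius.\<close>

lemma cover_in_subset:
  assumes "H \<subseteq> carrier G"
  obtains S where "finite S" "S \<subseteq> H" "\<And>x. x \<in> H \<Longrightarrow> d \<one> x \<le> R \<Longrightarrow> \<exists>s\<in>S. d s x \<le> 2 * r\<^sub>0"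
proof -
  obtain S where S: "finite S" "S \<subseteq> carrier G"
    "\<And>x. x \<in> carrier G \<Longrightarrow> d \<one> x \<le> R \<Longrightarrow> \<exists>s\<in>S. d s x \<le> r\<^sub>0"
    using cover[of R] by blast
  define S' where "S' = {s\<in>S. \<exists>x\<in>H. d s x \<le> r\<^sub>0}"
  have "\<forall>s\<in>S'. \<exists>x\<in>H. d s x \<le> r\<^sub>0"
    by (simp add: S'_def)
  then obtain p where p: "\<And>s. s \<in> S' \<Longrightarrow> p s \<in> H \<and> d s (p s) \<le> r\<^sub>0"
    by metis
  show thesis
  proof
    show "finite (p ` S')" "p ` S' \<subseteq> H"
      using S(1) p by (auto simp: S'_def)
    fix x assume x: "x \<in> H" "d \<one> x \<le> R"
    then obtain s where s: "s \<in> S" "d s x \<le> r\<^sub>0"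
      using S(3) assms by blast
    then have "s \<in> S'"
      using x by (auto simp: S'_def)
    then show "\<exists>s\<in>p ` S'. d s x \<le> 2 * r\<^sub>0"
      using p[of s] s triangle[of "p s" s x] S(2) assms x commute[of s "p s"]
      by (intro bexI[of _ "p s"]) (auto simp: subset_iff)
  qed
qed

section \<open>Layers of a cyclic extension\<close>

context
  fixes N :: "'a set" and s :: 'a
  assumes N: "subgroup N G" and s: "s \<in> carrier G"
    and conj: "\<And>(j::int) n. n \<in> N \<Longrightarrow> s [^] j \<otimes> n \<otimes> inv (s [^] j) \<in> N"
begin

abbreviation layer :: "int \<Rightarrow> 'a set" where
  "layer j \<equiv> N #> (s [^] j)"

lemma layer_in_carrier: "x \<in> layer j \<Longrightarrow> x \<in> carrier G"
  using r_coset_subset_G[OF subgroup.subset[OF N], of "s [^] j"] s by auto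

lemma pow_in_layer: "s [^] j \<in> layer j"
  using N s by (simp add: rcos_self)

lemma layer_0: "layer 0 = N"
  using N by (simp add: subgroup.subset)

lemma layer_mult:
  assumes "x \<in> layer i" "y \<in> layer j"
  shows "x \<otimes> y \<in> layer (i + j)"
proof -
  obtain n n' where n: "n \<in> N" "n' \<in> N" "x = n \<otimes> s [^] i" "y = n' \<otimes> s [^] j"
    using assms by (auto simp: r_coset_def)
  then have car: "n \<in> carrier G" "n' \<in> carrier G"
    using subgroup.mem_carrier[OF N] by auto
  have "x \<otimes> y = n \<otimes> (s [^] i \<otimes> n' \<otimes> inv (s [^] i)) \<otimes> s [^] (i + j)"
    unfolding n(3,4) int_pow_mult[OF s] using car s by (simp add: m_assoc inv_solve_left)
  moreover have "n \<otimes> (s [^] i \<otimes> n' \<otimes> inv (s [^] i)) \<in> N"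
    using N n(1) conj[OF n(2)] by (rule subgroup.m_closed)
  ultimately show ?thesis
    by (auto simp: r_coset_def)
qed

lemma layer_inv:
  assumes "x \<in> layer i"
  shows "inv x \<in> layer (- i)"
proof -
  obtain n where n: "n \<in> N" "x = n \<otimes> s [^] i"
    using assms by (auto simp: r_coset_def)
  then have "inv n \<in> layer 0"
    using subgroup.m_inv_closed[OF N] by (simp add: coset_mult_one subgroup.subset[OF N])
  from layer_mult[OF pow_in_layer this, of "- i"] show ?thesis
    using n N s by (simp add: inv_mult_group subgroup.mem_carrier int_pow_neg)
qed

lemma layers_subgroup: "subgroup (\<Union>j. layer j) G"
proof
  show "(\<Union>j. layer j) \<subseteq> carrier G"
    using layer_in_carrier by blast
  show "x \<otimes> y \<in> (\<Union>j. layer j)" if "x \<in> (\<Union>j. layer j)" "y \<in> (\<Union>j. layer j)" for x y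
    using that by (auto dest: layer_mult)
  show "\<one> \<in> (\<Union>j. layer j)"
    using pow_in_layer[of 0] by (intro UN_I[of 0]) simp_all
  show "inv x \<in> (\<Union>j. layer j)" if "x \<in> (\<Union>j. layer j)" for x
    using that by (auto dest: layer_inv)
qed

text \<open>By left invariance these are the index differences between points at distance at most
  \<open>r\<close>. At scale \<open>2 * r\<^sub>0\<close> they form the set of integers to which the
  bounded-gap lemma applies.\<close>

definition layer_shifts :: "real \<Rightarrow> int set" where
  "layer_shifts r = {j. \<exists>x\<in>layer j. d \<one> x \<le> r}"

lemma layer_shifts_dist:
  assumes "x \<in> layer i" "y \<in> layer j" "d x y \<le> r"
  shows "j - i \<in> layer_shifts r"
  using layer_mult[OF layer_inv[OF assms(1)] assms(2)] assms(3)
    dist_eq_length[OF layer_in_carrier[OF assms(1)] layer_in_carrier[OF assms(2)]]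
  unfolding layer_shifts_def by (intro CollectI bexI[of _ "inv x \<otimes> y"]) auto

lemma layer_shifts_uminus:
  assumes "j \<in> layer_shifts r"
  shows "- j \<in> layer_shifts r"
proof -
  obtain x where "x \<in> layer j" "d \<one> x \<le> r"
    using assms by (auto simp: layer_shifts_def)
  then show ?thesis
    using layer_inv[of x j] length_inv[OF layer_in_carrier[of x j]]
    unfolding layer_shifts_def by (intro CollectI bexI[of _ "inv x"]) auto
qed

lemma layer_shifts_add:
  assumes "i \<in> layer_shifts r" "j \<in> layer_shifts r'"
  shows "i + j \<in> layer_shifts (r + r')"
proof -
  obtain x y where "x \<in> layer i" "d \<one> x \<le> r" "y \<in> layer j" "d \<one> y \<le> r'"
    using assms by (auto simp: layer_shifts_def)
  then show ?thesis
    using layer_mult[of x i y j] length_mult[of x y] layer_in_carrier[of x] layer_in_carrier[of y]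
    unfolding layer_shifts_def by force
qed

text \<open>A point and a covering centre close to it have indices differing by a shift at scale
  \<open>2 * r\<^sub>0\<close>. Hence every shift set lies in finitely many translates of the one at
  that fixed scale.\<close>

lemma layer_shifts_cover:
  "\<exists>Z. finite Z \<and> (\<forall>j\<in>layer_shifts r. \<exists>z\<in>Z. j - z \<in> layer_shifts (2 * r\<^sub>0))"
proof -
  have "(\<Union>j. layer j) \<subseteq> carrier G"
    using layer_in_carrier by blast
  then obtain S where S: "finite S" "S \<subseteq> (\<Union>j. layer j)"
    "\<And>x. x \<in> (\<Union>j. layer j) \<Longrightarrow> d \<one> x \<le> r \<Longrightarrow> \<exists>s\<in>S. d s x \<le> 2 * r\<^sub>0"
    using cover_in_subset[of "\<Union>j. layer j" r] by (metis (no_types, lifting))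
  obtain h where h: "\<And>x. x \<in> S \<Longrightarrow> x \<in> layer (h x)"
    using S(2) by (metis (no_types, lifting) UN_E subsetD)
  show ?thesis
  proof (intro exI conjI ballI)
    show "finite (h ` S)"
      using S(1) by simp
    fix j assume "j \<in> layer_shifts r"
    then obtain x where x: "x \<in> layer j" "d \<one> x \<le> r"
      by (auto simp: layer_shifts_def)
    then obtain y where "y \<in> S" "d y x \<le> 2 * r\<^sub>0"
      using S(3) by blast
    then show "\<exists>z\<in>h ` S. j - z \<in> layer_shifts (2 * r\<^sub>0)"
      using layer_shifts_dist[OF h x(1)] by blast
  qed
qed

text \<open>The covering lemma makes the shifts at scale \<open>2 * r\<^sub>0\<close> infinite as
  well, and an approximate subgroup of the integers. They then have bounded gaps, so every layer
  contains an element of bounded length, which leads back to \<open>N\<close>.\<close>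

lemma layers_near_if_infinite_shifts:
  assumes "infinite (layer_shifts r)"
  obtains r' where "\<And>x. x \<in> (\<Union>j. layer j) \<Longrightarrow> \<exists>y\<in>N. d x y \<le> r'"
proof -
  let ?C = "layer_shifts (2 * r\<^sub>0)"
  have "infinite ?C"
  proof
    assume fin: "finite ?C"
    obtain Z where Z: "finite Z" "\<And>j. j \<in> layer_shifts r \<Longrightarrow> \<exists>z\<in>Z. j - z \<in> ?C"
      using layer_shifts_cover[of r] by blast
    have "layer_shifts r \<subseteq> (\<lambda>(z, c). z + c) ` (Z \<times> ?C)"
    proof
      fix j assume "j \<in> layer_shifts r"
      then obtain z where "z \<in> Z" "j - z \<in> ?C"
        using Z(2) by blast
      then show "j \<in> (\<lambda>(z, c). z + c) ` (Z \<times> ?C)"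
        by (intro image_eqI[of _ _ "(z, j - z)"]) auto
    qed
    then show False
      using assms fin Z(1) finite_subset by blast
  qed
  moreover have "0 \<in> ?C"
    using pow_in_layer[of 0] r0_nonneg
    by (auto simp: layer_shifts_def intro!: bexI[of _ \<one>])
  moreover from layer_shifts_cover[of "2 * r\<^sub>0 + 2 * r\<^sub>0"]
  obtain Z where Z: "finite Z" "\<And>j. j \<in> layer_shifts (2 * r\<^sub>0 + 2 * r\<^sub>0) \<Longrightarrow> \<exists>z\<in>Z. j - z \<in> ?C"
    by blast
  moreover have "\<exists>z\<in>Z. x + y - z \<in> ?C" if "x \<in> ?C" "y \<in> ?C" for x y
    using Z(2) layer_shifts_add that by blast
  ultimately have "\<exists>B. \<forall>x. \<exists>y\<in>?C. \<bar>x - y\<bar> \<le> B"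
    by (intro infinite_approximate_subgroup_int_syndetic[of ?C Z] layer_shifts_uminus)
  then obtain B where B: "\<And>x. \<exists>y\<in>?C. \<bar>x - y\<bar> \<le> B"
    by blast
  define r' where "r' = 2 * r\<^sub>0 + (\<Sum>i\<in>{-B..B}. d \<one> (s [^] i))"
  have "\<exists>y\<in>N. d x y \<le> r'" if "x \<in> layer j" for x j
  proof -
    obtain i where i: "i \<in> ?C" "\<bar>j - i\<bar> \<le> B"
      using B by blast
    then obtain b where b: "b \<in> layer i" "d \<one> b \<le> 2 * r\<^sub>0"
      by (auto simp: layer_shifts_def)
    \<comment> \<open>\<open>c\<close> is a short element of the layer of \<open>x\<close>; right
      multiplication by its inverse moves \<open>x\<close> into \<open>N\<close> over a distance
      equal to the length of \<open>c\<close>.\<close>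
    define c where "c = b \<otimes> s [^] (j - i)"
    have c: "c \<in> layer j" "c \<in> carrier G" "x \<in> carrier G"
      using layer_mult[OF b(1) pow_in_layer, of "j - i"] layer_in_carrier that by (auto simp: c_def)
    have "d \<one> (s [^] (j - i)) \<le> (\<Sum>i\<in>{-B..B}. d \<one> (s [^] i))"
      using i(2) by (intro member_le_sum) auto
    then have "d \<one> c \<le> r'"
      using length_mult[of b "s [^] (j - i)"] b layer_in_carrier s by (force simp: c_def r'_def)
    moreover have "x \<otimes> inv c \<in> N"
      using layer_mult[OF that layer_inv[OF c(1)]] layer_0 by simp
    moreover have "d x (x \<otimes> inv c) = d \<one> c"
      using c left_inv[of x \<one> "inv c"] length_inv by simp
    ultimately show ?thesis
      by (intro bexI[of _ "x \<otimes> inv c"]) simp_all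
  qed
  then show thesis
    using that by blast
qed

text \<open>The shift sets distinguish the two alternatives. If a nonzero power of \<open>s\<close>
  lies in \<open>N\<close>, layers repeat and the shift sets are infinite for every
  \<open>r \<ge> 0\<close>, so finite quotients belong to the case where everything is near
  \<open>N\<close>.\<close>

lemma sparsifiable_cyclic_extension:
  assumes sp: "sparsifiable d N"
  shows "sparsifiable d (\<Union>j. layer j)"
proof (cases "\<forall>r. finite (layer_shifts r)")
  case False
  then obtain r' where "\<And>x. x \<in> (\<Union>j. layer j) \<Longrightarrow> \<exists>y\<in>N. d x y \<le> r'"
    using layers_near_if_infinite_shifts by blast
  then show ?thesis
    using sparsifiable_thicken[OF Metric_space_axioms subgroup.subset[OF N]
        subgroup.subset[OF layers_subgroup] sp] by blast
next
  case True
  show ?thesis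
    unfolding sparsifiable_def
  proof (intro allI impI)
    fix m \<epsilon> :: real assume \<epsilon>: "0 < \<epsilon>"
    let ?K = "\<Union>j. layer j"
    obtain h where h: "\<And>x. x \<in> ?K \<Longrightarrow> x \<in> layer (h x)"
      by (metis UN_E)
    \<comment> \<open>\<open>J\<close> bounds the index difference of points at distance at most
      \<open>m\<close>, so dropping \<open>J\<close> layers separates what lies on either
      side.\<close>
    define J where "J = (\<Sum>j\<in>layer_shifts m. \<bar>j\<bar>)"
    have J: "0 \<le> J" "\<And>j. j \<in> layer_shifts m \<Longrightarrow> \<bar>j\<bar> \<le> J"
      unfolding J_def using True by (auto intro: sum_nonneg member_le_sum)
    \<comment> \<open>The period \<open>L\<close> makes the dropped share \<open>J / L\<close> at
      most \<open>\<epsilon> / 2\<close>; \<open>max 1\<close> keeps it positive when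
      \<open>J = 0\<close>.\<close>
    define L where "L = max 1 \<lceil>2 * J / \<epsilon>\<rceil>"
    have L: "0 < L" "of_int J \<le> \<epsilon> / 2 * of_int L"
    proof -
      have "2 * of_int J / \<epsilon> \<le> of_int L"
        unfolding L_def by linarith
      then show "of_int J \<le> \<epsilon> / 2 * of_int L"
        using \<epsilon> by (simp add: field_simps)
    qed (simp add: L_def)
    define W where "W = (\<Union>i\<in>{0..<L}. layer i)"
    have W: "W \<subseteq> carrier G"
      using layer_in_carrier by (auto simp: W_def)
    have "\<exists>y\<in>N. d x y \<le> (\<Sum>i\<in>{0..<L}. d \<one> (s [^] i))" if "x \<in> W" for x
    proof -
      obtain i n where i: "i \<in> {0..<L}" "n \<in> N" "x = n \<otimes> s [^] i"
        using \<open>x \<in> W\<close> by (auto simp: W_def r_coset_def)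
      then have "d x n = d \<one> (s [^] i)"
        using left_inv[of n \<one> "s [^] i"] commute[of n x] s subgroup.mem_carrier[OF N] by simp
      also have "\<dots> \<le> (\<Sum>i\<in>{0..<L}. d \<one> (s [^] i))"
        using i(1) by (intro member_le_sum) auto
      finally show ?thesis
        using i(2) by blast
    qed
    then have "sparsifiable d W"
      using sparsifiable_thicken[OF Metric_space_axioms subgroup.subset[OF N] W sp] by blast
    then obtain R where R: "sparsifies d m (\<epsilon> / 2) R W"
      using \<epsilon> unfolding sparsifiable_def by (meson half_gt_zero)
    \<comment> \<open>\<open>S t\<close> drops the lowest \<open>J\<close> of every \<open>L\<close> consecutive layers, counted from \<open>t\<close>.\<close>
    define S where "S t = {x\<in>?K. J \<le> (h x - t) mod L}" for t
    have "sparsifies d m (\<epsilon> / 2 + \<epsilon> / 2) R ?K"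
    proof (rule sparsifies_average)
      show "finite {0..<L}" "{0..<L} \<noteq> {}"
        using L by auto
    next
      fix t
      show "sparsifies d m (\<epsilon> / 2) R (S t)"
      proof (rule sparsifies_glue[where h = "\<lambda>x. (h x - t) div L"])
        fix q
        \<comment> \<open>Left multiplication by \<open>inv g\<close> lowers layer indices by
          \<open>t + L * q\<close>, which takes the block numbered \<open>q\<close> into
          \<open>W\<close>. One \<open>R\<close> therefore serves all blocks.\<close>
        define g where "g = s [^] (t + L * q)"
        have g: "g \<in> carrier G"
          using s by (simp add: g_def)
        have "{x\<in>S t. (h x - t) div L = q} \<subseteq> {x\<in>carrier G. inv g \<otimes> x \<in> W}"
        proof clarify
          fix x assume "x \<in> S t" and q: "q = (h x - t) div L"
          then have x: "x \<in> layer (h x)"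
            using h by (auto simp: S_def)
          have "h x - t = L * q + (h x - t) mod L"
            unfolding q by simp
          then have "- (t + L * q) + h x = (h x - t) mod L"
            by simp
          then have "inv g \<otimes> x \<in> layer ((h x - t) mod L)"
            using layer_mult[OF layer_inv[OF pow_in_layer] x, of "t + L * q"] by (simp only: g_def)
          then show "x \<in> carrier G \<and> inv g \<otimes> x \<in> W"
            using layer_in_carrier[OF x] L(1) by (auto simp: W_def)
        qed
        then show "sparsifies d m (\<epsilon> / 2) R {x\<in>S t. (h x - t) div L = q}"
          using sparsifies_translate[OF R W g] sparsifies_subset by blast
      next
        fix x y assume xy: "x \<in> S t" "y \<in> S t" and ne: "(h x - t) div L \<noteq> (h y - t) div L"
        \<comment> \<open>\<open>a\<close> precedes the start of the block of \<open>b\<close>,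
          while \<open>b\<close> lies at least \<open>J\<close> past that start; hence the strict
          inequality.\<close>
        have lt: "J < b - a"
          if "a div L < b div L" "J \<le> b mod L" for a b
        proof -
          have "L * (a div L + 1) \<le> L * (b div L)"
            using that(1) L(1) by (intro mult_left_mono) auto
          moreover have "a = L * (a div L) + a mod L" "b = L * (b div L) + b mod L" "a mod L < L"
            using L(1) by auto
          ultimately show ?thesis
            using that(2) unfolding distrib_left mult_1_right by linarith
        qed
        have "J < \<bar>h y - h x\<bar>"
          using ne lt[of "h x - t" "h y - t"] lt[of "h y - t" "h x - t"] xy
          by (auto simp: S_def neq_iff)
        then have "h y - h x \<notin> layer_shifts m"
          using J(2) by force
        then show "m \<le> d x y"
          using layer_shifts_dist[of x "h x" y "h y" m] h xy by (force simp: S_def)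
      qed
    next
      fix x assume x: "x \<in> ?K"
      \<comment> \<open>As \<open>t\<close> runs through one period, the residues of
        \<open>h x - t\<close> are distinct, and \<open>x\<close> is dropped only for residues below
        \<open>J\<close>: at most \<open>J\<close> of the \<open>L\<close> choices.\<close>
      have "inj_on (\<lambda>t. (h x - t) mod L) {0..<L}"
      proof (rule inj_onI)
        fix t t' assume t: "t \<in> {0..<L}" "t' \<in> {0..<L}" and "(h x - t) mod L = (h x - t') mod L"
        then have "L dvd t' - t"
          using mod_eq_dvd_iff[of "h x - t" L "h x - t'"] by simp
        then show "t = t'"
          using t zdvd_imp_le[of L "t' - t"] zdvd_imp_le[of L "t - t'"] dvd_minus_iff[of L "t' - t"]
          by (cases t t' rule: linorder_cases) auto
      qed
      then have "inj_on (\<lambda>t. (h x - t) mod L) {t\<in>{0..<L}. x \<notin> S t}"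
        by (rule inj_on_subset) auto
      moreover have "(\<lambda>t. (h x - t) mod L) ` {t\<in>{0..<L}. x \<notin> S t} \<subseteq> {0..<J}"
        using L(1) x by (auto simp: S_def)
      ultimately have "card {t\<in>{0..<L}. x \<notin> S t} \<le> card {0..<J}"
        by (rule card_inj_on_le) simp
      then have "real (card {t\<in>{0..<L}. x \<notin> S t}) \<le> of_int J"
        using J(1) by simp
      also have "\<dots> \<le> \<epsilon> / 2 * of_int L"
        by (rule L(2))
      also have "of_int L = real (card {0..<L})"
        using L(1) by simp
      finally show "real (card {t\<in>{0..<L}. x \<notin> S t}) \<le> \<epsilon> / 2 * real (card {0..<L})" .
    qed (use \<epsilon> in simp)
    then show "\<exists>R. sparsifies d m \<epsilon> R ?K"
      by auto
  qed
qed

end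

section \<open>Abelian extensions and the solvable series\<close>

lemma conj_mem_if_derived_subset:
  assumes "derived G H \<subseteq> N" "subgroup N G" "subgroup H G" "N \<subseteq> H" "g \<in> H" "n \<in> N"
  shows "g \<otimes> n \<otimes> inv g \<in> N"
proof -
  have car: "g \<in> carrier G" "n \<in> carrier G"
    using assms subgroup.mem_carrier[OF assms(3)] by auto
  \<comment> \<open>The conjugate is the commutator of \<open>g\<close> and \<open>n\<close> times
    \<open>n\<close>.\<close>
  have "g \<otimes> n \<otimes> inv g \<otimes> inv n \<in> derived G H"
    unfolding derived_def using assms(4-6) by (intro generate.incl) blast
  then have "(g \<otimes> n \<otimes> inv g \<otimes> inv n) \<otimes> n \<in> N"
    using assms(1,6) subgroup.m_closed[OF assms(2)] by auto
  then show ?thesis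
    using car by (simp add: m_assoc)
qed

text \<open>One generator is adjoined at a time. Each intermediate subgroup contains
  \<open>derived G H\<close>, hence is normalised by \<open>H\<close>, so the cyclic extension lemma
  applies again.\<close>

lemma sparsifiable_finite_extension:
  assumes H: "subgroup H G" and N: "subgroup N G" "N \<subseteq> H" "derived G H \<subseteq> N" "sparsifiable d N"
    and S: "finite S" "S \<subseteq> H"
  shows "sparsifiable d (generate G (N \<union> S))"
  using S
proof (induction S)
  case empty
  have "generate G N \<subseteq> N"
    using N(1) by (simp add: generate_subgroup_incl)
  then show ?case
    using N(4) sparsifiable_subset by auto
next
  case (insert s S)
  let ?M = "generate G (N \<union> S)"
  have NS: "N \<union> S \<subseteq> carrier G"
    using N(2) insert.prems subgroup.subset[OF H] by auto
  then have M: "subgroup ?M G" "N \<union> S \<subseteq> ?M"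
    by (auto simp: generate_is_subgroup generate.incl)
  have MH: "?M \<subseteq> H"
    using generate_subgroup_incl[OF _ H, of "N \<union> S"] N(2) insert.prems by simp
  have s: "s \<in> carrier G"
    using insert.prems subgroup.subset[OF H] by auto
  have pow: "s [^] j \<in> H" for j :: int
    using H insert.prems by (simp add: subgroup_int_pow_closed)
  have "derived G H \<subseteq> ?M"
    by (rule order_trans[OF N(3)]) (use M(2) in simp)
  then have conj: "s [^] j \<otimes> n \<otimes> inv (s [^] j) \<in> ?M" if "n \<in> ?M" for j :: int and n
    using M(1) H MH pow that by (rule conj_mem_if_derived_subset)
  have "sparsifiable d ?M"
    using insert by simp
  then have "sparsifiable d (\<Union>j::int. ?M #> s [^] j)"
    using sparsifiable_cyclic_extension[OF M(1) s conj] by simp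
  moreover have "generate G (N \<union> insert s S) \<subseteq> (\<Union>j::int. ?M #> s [^] j)"
  proof (rule generate_subgroup_incl[OF _ layers_subgroup[OF M(1) s conj]])
    show "N \<union> insert s S \<subseteq> (\<Union>j::int. ?M #> s [^] j)"
    proof -
      have "?M \<subseteq> (\<Union>j::int. ?M #> s [^] j)"
        using UN_upper[of 0 UNIV "\<lambda>j::int. ?M #> s [^] j"] layer_0[OF M(1) s conj] by simp
      moreover have "s \<in> (\<Union>j::int. ?M #> s [^] j)"
        using pow_in_layer[OF M(1) s conj, of 1] s by (intro UN_I[of 1]) simp_all
      ultimately show ?thesis
        using M(2) by blast
    qed
  qed
  ultimately show ?case
    by (rule sparsifiable_subset)
qed

text \<open>The finite extension lemma handles \<open>M\<close>; the main point is that
  \<open>A\<close>, generated by possibly infinitely many short elements, stays within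
  \<open>2 * r\<^sub>0\<close> of \<open>M\<close>. Both may depend on \<open>m\<close>, since
  \<open>R\<close> may.\<close>

lemma sparsifiable_abelian_extension:
  assumes H: "subgroup H G" and N: "subgroup N G" "N \<subseteq> H" "derived G H \<subseteq> N" "sparsifiable d N"
  shows "sparsifiable d H"
  unfolding sparsifiable_def
proof (intro allI impI)
  fix m \<epsilon> :: real assume \<epsilon>: "0 < \<epsilon>"
  have HG: "\<And>x. x \<in> H \<Longrightarrow> x \<in> carrier G" and NG: "\<And>x. x \<in> N \<Longrightarrow> x \<in> carrier G"
    using subgroup.mem_carrier[OF H] subgroup.mem_carrier[OF N(1)] by auto
  note H_closed = subgroup.m_closed[OF H] subgroup.m_inv_closed[OF H]
  \<comment> \<open>The radius allows for a remainder of length at most \<open>2 * r\<^sub>0\<close>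
    times a generator of length at most \<open>m\<close>.\<close>
  obtain S where S: "finite S" "S \<subseteq> H"
    "\<And>x. x \<in> H \<Longrightarrow> d \<one> x \<le> 2 * r\<^sub>0 + m \<Longrightarrow> \<exists>s\<in>S. d s x \<le> 2 * r\<^sub>0"
    using cover_in_subset[of H] HG by (metis subsetI)
  define M where "M = generate G (N \<union> S)"
  have M: "subgroup M G" "N \<union> S \<subseteq> M" "sparsifiable d M" "M \<subseteq> H"
    using generate_is_subgroup[of "N \<union> S"] sparsifiable_finite_extension[OF H N S(1,2)]
      generate_subgroup_incl[of "N \<union> S", OF _ H] N(2) S(2) HG
    by (auto simp: M_def generate.incl)
  define X where "X = N \<union> {x\<in>H. d \<one> x \<le> m}"
  define A where "A = generate G X"
  have X: "X \<subseteq> H" "\<And>x. x \<in> X \<Longrightarrow> inv x \<in> X"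
    using N(2) H_closed subgroup.m_inv_closed[OF N(1)] length_inv HG by (auto simp: X_def)
  have A: "subgroup A G" "X \<subseteq> A" "A \<subseteq> H"
    using generate_is_subgroup[of X] generate_subgroup_incl[OF X(1) H] X(1) HG
    by (auto simp: A_def generate.incl)
  \<comment> \<open>\<open>Q\<close> is shown to be stable under right multiplication by the
    generators of \<open>A\<close>; containing \<open>\<one>\<close>, it then contains
    \<open>A\<close>.\<close>
  define Q where "Q = {x\<in>H. \<exists>e\<in>M. d e x \<le> 2 * r\<^sub>0}"
  have Q_mult_X: "q \<otimes> x \<in> Q" if q: "q \<in> Q" and x: "x \<in> X" for q x
  proof -
    obtain e where e: "e \<in> M" "d e q \<le> 2 * r\<^sub>0" and qH: "q \<in> H"
      using q by (auto simp: Q_def)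
    define b where "b = inv e \<otimes> q"
    have bH: "b \<in> H" and xH: "x \<in> H" and eH: "e \<in> H"
      using e(1) M(4) qH H_closed x X(1) by (auto simp: b_def)
    note car = HG[OF bH] HG[OF xH] HG[OF eH] HG[OF qH]
    have qe: "q = e \<otimes> b"
      using car by (simp add: b_def m_assoc[symmetric])
    have b: "d \<one> b \<le> 2 * r\<^sub>0"
      using e(2) dist_eq_length[of e q] car by (simp add: b_def)
    have "\<exists>e'\<in>M. d e' (q \<otimes> x) \<le> 2 * r\<^sub>0"
    \<comment> \<open>With \<open>q = e \<otimes> b\<close>, a factor from \<open>N\<close> is
      conjugated past \<open>b\<close> and absorbed into \<open>M\<close>, leaving the remainder
      \<open>b\<close>. A short factor keeps \<open>b \<otimes> x\<close> within the range of
      \<open>S\<close>, whose nearby element \<open>t\<close> is absorbed instead. Either way the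
      error does not accumulate.\<close>
    proof (cases "x \<in> N")
      case True
      define n where "n = b \<otimes> x \<otimes> inv b"
      have n: "n \<in> N"
        unfolding n_def by (rule conj_mem_if_derived_subset[OF N(3,1) H N(2) bH True])
      have "q \<otimes> x = e \<otimes> n \<otimes> b"
        using car by (simp add: n_def qe m_assoc)
      then have "d (e \<otimes> n) (q \<otimes> x) = d \<one> b"
        using left_inv[of "e \<otimes> n" \<one> b] car NG[OF n] by simp
      then show ?thesis
        using b n M(2) e(1) subgroup.m_closed[OF M(1)] by (intro bexI[of _ "e \<otimes> n"]) auto
    next
      case False
      then have "d \<one> (b \<otimes> x) \<le> 2 * r\<^sub>0 + m"
        using x length_mult[of b x] car b by (auto simp: X_def)
      then obtain t where t: "t \<in> S" "d t (b \<otimes> x) \<le> 2 * r\<^sub>0"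
        using S(3)[OF H_closed(1)[OF bH xH]] by blast
      then have "d (e \<otimes> t) (q \<otimes> x) \<le> 2 * r\<^sub>0"
        using left_inv[of e t "b \<otimes> x"] car S(2) HG by (auto simp: qe m_assoc subset_iff)
      then show ?thesis
        using t M(2) e(1) subgroup.m_closed[OF M(1)] by (intro bexI[of _ "e \<otimes> t"]) auto
    qed
    then show ?thesis
      using qH xH H_closed by (auto simp: Q_def)
  qed
  \<comment> \<open>Quantifying over \<open>q\<close> inside the induction turns the product case
    into two successive right multiplications.\<close>
  have Q_mult_A: "\<forall>q\<in>Q. q \<otimes> a \<in> Q" if "a \<in> A" for a
    using that unfolding A_def
  proof induction
    case one
    then show ?case
      using HG by (auto simp: Q_def)
  next
    case (eng h1 h2)
    then have "h1 \<in> carrier G" "h2 \<in> carrier G"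
      using A(3) HG by (auto simp: A_def)
    moreover have "\<And>q. q \<in> Q \<Longrightarrow> q \<in> carrier G"
      using HG by (simp add: Q_def)
    ultimately show ?case
      using eng by (metis m_assoc)
  qed (use Q_mult_X X(2) in auto)
  have "\<one> \<in> Q"
    using subgroup.one_closed[OF M(1)] subgroup.one_closed[OF H] r0_nonneg
    by (auto simp: Q_def intro!: bexI[of _ \<one>])
  then have "\<one> \<otimes> a \<in> Q" if "a \<in> A" for a
    using Q_mult_A[OF that] by blast
  then have "A \<subseteq> Q"
    using A(3) HG by (metis l_one subsetD subsetI)
  then have "\<exists>y\<in>M. d x y \<le> 2 * r\<^sub>0" if "x \<in> A" for x
    using that commute[of x] by (fastforce simp: Q_def)
  then have "sparsifiable d A"
    using sparsifiable_thicken[OF Metric_space_axioms subgroup.subset[OF M(1)]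
        subgroup.subset[OF A(1)] M(3)] by blast
  then obtain R where R: "sparsifies d m \<epsilon> R A"
    using \<epsilon> unfolding sparsifiable_def by blast
  \<comment> \<open>\<open>h x\<close> is the left coset \<open>x A\<close>; left cosets match a
    left-invariant metric, since \<open>d x y\<close> is the length of
    \<open>inv x \<otimes> y\<close>.\<close>
  define h where "h x = {y\<in>carrier G. inv x \<otimes> y \<in> A}" for x
  have h_eq: "h x \<subseteq> h y" if "y \<in> carrier G" "x \<in> carrier G" "inv y \<otimes> x \<in> A" for x y
  proof
    fix z assume z: "z \<in> h x"
    then have "(inv y \<otimes> x) \<otimes> (inv x \<otimes> z) \<in> A"
      using that(3) subgroup.m_closed[OF A(1)] by (simp add: h_def)
    moreover have "x \<otimes> (inv x \<otimes> z) = z"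
      using that z by (simp add: h_def m_assoc[symmetric])
    then have "(inv y \<otimes> x) \<otimes> (inv x \<otimes> z) = inv y \<otimes> z"
      using that z by (simp add: h_def m_assoc)
    ultimately show "z \<in> h y"
      using z by (simp add: h_def)
  qed
  have "sparsifies d m \<epsilon> R H"
  proof (rule sparsifies_glue[where h = h])
    fix j
    show "sparsifies d m \<epsilon> R {x\<in>H. h x = j}"
    proof (cases "\<exists>g\<in>H. h g = j")
      case True
      then obtain g where g: "g \<in> H" "h g = j" ..
      have "{x\<in>H. h x = j} \<subseteq> {x\<in>carrier G. inv g \<otimes> x \<in> A}"
      proof clarify
        fix x assume x: "x \<in> H" "j = h x"
        then have "x \<in> h x"
          using HG subgroup.one_closed[OF A(1)] by (simp add: h_def)
        then have "x \<in> h g"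
          using x g by simp
        then show "x \<in> carrier G \<and> inv g \<otimes> x \<in> A"
          by (simp add: h_def)
      qed
      then show ?thesis
        by (rule sparsifies_subset[OF sparsifies_translate[OF R subgroup.subset[OF A(1)] HG[OF g(1)]]])
    next
      case False
      then have "{x\<in>H. h x = j} \<subseteq> A"
        by auto
      then show ?thesis
        by (rule sparsifies_subset[OF R])
    qed
  next
    fix x y assume xy: "x \<in> H" "y \<in> H" "h x \<noteq> h y"
    have "inv x \<otimes> y \<notin> A"
    proof
      assume A': "inv x \<otimes> y \<in> A"
      then have "inv (inv x \<otimes> y) \<in> A"
        by (rule subgroup.m_inv_closed[OF A(1)])
      then have "inv y \<otimes> x \<in> A"
        using xy HG by (simp add: inv_mult_group)
      then show False
        using h_eq[of x y] h_eq[of y x] A' xy HG by (simp add: subset_antisym)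
    qed
    moreover have "inv x \<otimes> y \<in> H"
      by (rule H_closed(1)[OF H_closed(2)[OF xy(1)] xy(2)])
    ultimately have "\<not> d \<one> (inv x \<otimes> y) \<le> m"
      using A(2) by (auto simp: X_def)
    then show "m \<le> d x y"
      using dist_eq_length[of x y] xy HG by simp
  qed
  then show "\<exists>R. sparsifies d m \<epsilon> R H" ..
qed

text \<open>Along the series, normality of \<open>K\<close> with commutative quotient gives
  \<open>derived G H \<subseteq> K\<close>, the hypothesis of the abelian step.\<close>

theorem sparsifiable_solvable:
  assumes "solvable_seq G H"
  shows "sparsifiable d H"
  using assms
proof induction
  case unity
  then show ?case
    unfolding sparsifiable_def by (intro allI impI exI[of _ 0]) (simp add: sparsifies_singleton)
next
  case (extension K H)
  have "K \<subseteq> H"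
    using subgroup.subset[OF normal_imp_subgroup[OF extension.hyps(2)]] by simp
  then show ?case
    using sparsifiable_abelian_extension[OF extension.hyps(3) solvable_imp_subgroup[OF extension.hyps(1)]]
      derived_of_subgroup_minimal[OF extension.hyps(2-4)] extension.IH by simp
qed

end

section \<open>Borel measures on the group\<close>

lemma sets_borel_on_openin: "openin T U \<Longrightarrow> U \<in> sets (borel_on T)"
  unfolding borel_on_def by (rule in_measure_of) (auto dest: openin_subset)

lemma space_borel_on: "space (borel_on T) = topspace T"
  unfolding borel_on_def by (rule space_measure_of) (auto dest: openin_subset)

text \<open>Every point is sent to the centre of the first \<open>V n\<close> containing it. This
  map \<open>p\<close> moves points by at most \<open>r\<close> and has countably many values with
  Borel fibres, so pieces found among finitely many centres pull back to Borel sets.\<close>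

lemma metric_sparsification_if_sparsifiable:
  fixes x :: "nat \<Rightarrow> 'a" and V :: "nat \<Rightarrow> 'a set"
  assumes "Metric_space (topspace T) d"
    and x: "\<And>n. x n \<in> topspace T"
    and V: "\<And>n. openin T (V n)" "topspace T = (\<Union>n. V n)"
    and near: "\<And>n y. y \<in> V n \<Longrightarrow> d (x n) y \<le> r"
    and sp: "sparsifiable d (topspace T)"
    and c: "0 < c" "c < 1"
  shows "metric_sparsification T d c"
proof -
  interpret Metric_space "topspace T" d by fact
  let ?X = "topspace T"
  define idx where "idx y = (LEAST n. y \<in> V n)" for y
  have idx: "y \<in> V (idx y)" if y: "y \<in> ?X" for y
  proof -
    obtain n where "y \<in> V n"
      using y unfolding V(2) by blast
    then show ?thesis
      unfolding idx_def by (rule LeastI)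
  qed
  have idx_le: "idx y \<le> n" if "y \<in> V n" for y n
    unfolding idx_def using that by (rule Least_le)
  define p where "p y = x (idx y)" for y
  have p: "p y \<in> ?X" "d (p y) y \<le> r" if "y \<in> ?X" for y
    using x near idx[OF that] by (auto simp: p_def)
  have idx_sets: "{y\<in>?X. idx y = n} \<in> sets (borel_on T)" for n
  proof -
    have "{y\<in>?X. idx y = n} = V n - (\<Union>k<n. V k)"
    proof (intro equalityI subsetI)
      fix y assume "y \<in> {y\<in>?X. idx y = n}"
      then show "y \<in> V n - (\<Union>k<n. V k)"
        using idx[of y] idx_le[of y] by fastforce
    next
      fix y assume y: "y \<in> V n - (\<Union>k<n. V k)"
      then have "y \<in> ?X" "idx y \<le> n"
        using V(2) idx_le by auto
      moreover from this have "\<not> idx y < n"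
        using idx y by blast
      ultimately show "y \<in> {y\<in>?X. idx y = n}"
        by simp
    qed
    moreover have "V n - (\<Union>k<n. V k) \<in> sets (borel_on T)"
      using V(1) by (intro sets.Diff sets.finite_UN) (auto intro: sets_borel_on_openin)
    ultimately show ?thesis
      by simp
  qed
  have p_sets: "{y\<in>?X. p y \<in> A} \<in> sets (borel_on T)" for A
  proof -
    have "{y\<in>?X. p y \<in> A} = (\<Union>n\<in>{n. x n \<in> A}. {y\<in>?X. idx y = n})"
      by (auto simp: p_def)
    then show ?thesis
      using idx_sets by auto
  qed
  \<comment> \<open>One \<open>\<epsilon>\<close> is spent on restricting to finitely many centres,
    the other on sparsifying; the final bound uses
    \<open>(1 - \<epsilon>)^2 \<ge> 1 - 2 * \<epsilon>\<close>.\<close>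
  define \<epsilon> where "\<epsilon> = (1 - c) / 2"
  have \<epsilon>: "0 < \<epsilon>" "\<epsilon> < 1" "c = 1 - 2 * \<epsilon>"
    using c by (auto simp: \<epsilon>_def field_simps)
  have "\<forall>m::nat. \<exists>R. sparsifies d (real m + 2 * r) \<epsilon> R ?X"
    using sp \<epsilon>(1) unfolding sparsifiable_def by simp
  then obtain R where R: "\<And>m::nat. sparsifies d (real m + 2 * r) \<epsilon> (R m) ?X"
    by metis
  \<comment> \<open>Partial sums make \<open>f\<close> monotone while still dominating each
    \<open>R m + 2 * r\<close>.\<close>
  define f where "f m = (\<Sum>k\<le>m. nat \<lceil>R k + 2 * r\<rceil>)" for m
  have "mono f"
    by (auto simp: f_def mono_def intro!: sum_mono2)
  have f: "R m + 2 * r \<le> real (f m)" for m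
  proof -
    have "nat \<lceil>R m + 2 * r\<rceil> \<le> f m"
      unfolding f_def by (rule member_le_sum) auto
    then show ?thesis
      by linarith
  qed
  have "\<exists>(I :: 'a set) \<Omega>. disjoint_family_on \<Omega> I \<and> (\<Union>i\<in>I. \<Omega> i) \<in> sets (borel_on T) \<and>
            (\<forall>i\<in>I. \<forall>j\<in>I. i \<noteq> j \<longrightarrow> of_nat m \<le> set_distance d (\<Omega> i) (\<Omega> j)) \<and>
            (\<forall>i\<in>I. set_diameter d (\<Omega> i) \<le> of_nat (f m)) \<and>
            c * measure \<mu> (space \<mu>) \<le> measure \<mu> (\<Union>i\<in>I. \<Omega> i)"
    if \<mu>: "sets \<mu> = sets (borel_on T)" "finite_measure \<mu>" for m and \<mu> :: "'a measure"
  proof -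
    interpret \<mu>: finite_measure \<mu> by fact
    have space: "space \<mu> = ?X"
      using sets_eq_imp_space_eq[OF \<mu>(1)] by (simp add: space_borel_on)
    define D where "D n = (\<Union>k<n. V k)" for n :: nat
    have D_sets: "D n \<in> sets \<mu>" for n
      unfolding D_def \<mu>(1) using V(1) by (intro sets.finite_UN) (auto intro: sets_borel_on_openin)
    have "incseq D"
      by (force simp: D_def incseq_def)
    then have "(\<lambda>n. measure \<mu> (D n)) \<longlonglongrightarrow> measure \<mu> (\<Union>n. D n)"
      using D_sets by (intro \<mu>.finite_Lim_measure_incseq) auto
    moreover have "(\<Union>n. D n) = ?X"
      using V(2) by (auto simp: D_def)
    ultimately have lim: "(\<lambda>n. measure \<mu> (D n)) \<longlonglongrightarrow> measure \<mu> ?X"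
      by simp
    obtain n where n: "(1 - \<epsilon>) * measure \<mu> ?X \<le> measure \<mu> (D n)"
    proof (cases "measure \<mu> ?X = 0")
      case True
      then show ?thesis
        using that[of 0] by simp
    next
      case False
      then have "0 < measure \<mu> ?X"
        by (simp add: zero_less_measure_iff)
      then have "(1 - \<epsilon>) * measure \<mu> ?X < measure \<mu> ?X"
        using \<epsilon> by simp
      then have "eventually (\<lambda>n. (1 - \<epsilon>) * measure \<mu> ?X < measure \<mu> (D n)) sequentially"
        by (rule order_tendstoD(1)[OF lim])
      then show ?thesis
        using that by (auto simp: eventually_sequentially intro: less_imp_le)
    qed
    define F where "F = x ` {..<n}"
    have F: "finite F" "F \<subseteq> ?X"
      using x by (auto simp: F_def)
    define w where "w a = measure \<mu> {y\<in>?X. p y = a}" for a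
    have w: "0 \<le> w a" for a
      by (simp add: w_def)
    have sum_w: "sum w A = measure \<mu> {y\<in>?X. p y \<in> A}" if "finite A" for A
    proof -
      have "measure \<mu> (\<Union>a\<in>A. {y\<in>?X. p y = a}) = (\<Sum>a\<in>A. measure \<mu> {y\<in>?X. p y = a})"
        using that p_sets[of "{a}" for a] \<mu>(1)
        by (intro \<mu>.finite_measure_finite_Union) (auto simp: disjoint_family_on_def)
      moreover have "(\<Union>a\<in>A. {y\<in>?X. p y = a}) = {y\<in>?X. p y \<in> A}"
        by auto
      ultimately show ?thesis
        by (simp add: w_def)
    qed
    from sparsifiesE[OF R[of m] F, of w, OF w]
    obtain \<Omega> E where O: "\<Omega> \<subseteq> F" "equivp E"
      "\<And>x y. x \<in> \<Omega> \<Longrightarrow> y \<in> \<Omega> \<Longrightarrow> E x y \<Longrightarrow> d x y \<le> R m"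
      "\<And>x y. x \<in> \<Omega> \<Longrightarrow> y \<in> \<Omega> \<Longrightarrow> \<not> E x y \<Longrightarrow> real m + 2 * r \<le> d x y"
      "(1 - \<epsilon>) * sum w F \<le> sum w \<Omega>"
      by (metis (no_types, lifting))
    have E: "\<And>a. E a a" "\<And>a b. E a b \<Longrightarrow> E b a" "\<And>a b c. E a b \<Longrightarrow> E b c \<Longrightarrow> E a c"
      using O(2) unfolding equivp_reflp_symp_transp reflp_def symp_def transp_def by blast+
    \<comment> \<open>The index set has to consist of points, so every class gets one
      representative; equivalent points get the same one because the choice depends only on the
      class.\<close>
    define rep where "rep a = (SOME b. b \<in> \<Omega> \<and> E a b)" for a
    have rep: "rep a \<in> \<Omega> \<and> E a (rep a)" if "a \<in> \<Omega>" for a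
      unfolding rep_def by (rule someI[of "\<lambda>b. b \<in> \<Omega> \<and> E a b" a]) (use that E(1) in simp)
    have rep_eq: "rep a = rep b" if "E a b" for a b
    proof -
      have "E a z \<longleftrightarrow> E b z" for z
        using E(3)[OF that, of z] E(3)[OF E(2)[OF that], of z] by blast
      then show ?thesis
        by (simp add: rep_def)
    qed
    define P where "P i = {y\<in>?X. p y \<in> \<Omega> \<and> E (p y) i}" for i
    have rep_rep: "i = j" if "i \<in> rep ` \<Omega>" "j \<in> rep ` \<Omega>" "E i j" for i j
    proof -
      have "rep (rep a) = rep a" if "a \<in> \<Omega>" for a
        using rep[OF that] rep_eq[of a "rep a"] by simp
      then have "rep i = i" "rep j = j"
        using that(1,2) by auto
      then show ?thesis
        using rep_eq[OF that(3)] by metis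
    qed
    have Union: "(\<Union>i\<in>rep ` \<Omega>. P i) = {y\<in>?X. p y \<in> \<Omega>}"
      using rep by (auto simp: P_def)
    have dist_p: "d (p y) (p z) \<le> d y z + 2 * r" "d y z \<le> d (p y) (p z) + 2 * r"
      if "y \<in> ?X" "z \<in> ?X" for y z
      using p[OF that(1)] p[OF that(2)] that
        triangle[of "p y" y "p z"] triangle[of y z "p z"] triangle[of y "p y" z] triangle[of "p y" "p z" z]
        commute[of "p z" z] commute[of "p y" y]
      by auto
    show ?thesis
    proof (rule exI[of _ "rep ` \<Omega>"], rule exI[of _ P], intro conjI ballI impI)
      show "disjoint_family_on P (rep ` \<Omega>)"
        unfolding disjoint_family_on_def
      proof (intro ballI impI equals0I)
        fix i j y assume ij: "i \<in> rep ` \<Omega>" "j \<in> rep ` \<Omega>" "i \<noteq> j" and "y \<in> P i \<inter> P j"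
        then have "E i (p y)" "E (p y) j"
          using E(2) by (auto simp: P_def)
        then show False
          using rep_rep[OF ij(1,2) E(3)] ij(3) by simp
      qed
      show "(\<Union>i\<in>rep ` \<Omega>. P i) \<in> sets (borel_on T)"
        unfolding Union by (rule p_sets)
      show "of_nat m \<le> set_distance d (P i) (P j)"
        if ij: "i \<in> rep ` \<Omega>" "j \<in> rep ` \<Omega>" "i \<noteq> j" for i j
        unfolding set_distance_def
      proof (intro INF_greatest)
        fix y z assume y: "y \<in> P i" and z: "z \<in> P j"
        have "\<not> E (p y) (p z)"
        proof
          assume "E (p y) (p z)"
          moreover have "E i (p y)" "E (p z) j"
            using y z E(2) by (auto simp: P_def)
          ultimately have "E i j"
            using E(3) by metis
          then show False
            using rep_rep[OF ij(1,2)] ij(3) by simp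
        qed
        then have "real m \<le> d y z"
          using O(4)[of "p y" "p z"] dist_p(1)[of y z] y z by (auto simp: P_def)
        then show "of_nat m \<le> ennreal (d y z)"
          by (simp add: ennreal_of_nat_eq_real_of_nat ennreal_leI)
      qed
      show "set_diameter d (P i) \<le> of_nat (f m)" for i
        unfolding set_diameter_def
      proof (intro SUP_least)
        fix y z assume y: "y \<in> P i" and z: "z \<in> P i"
        then have "E (p y) i" "E i (p z)"
          using E(2) by (auto simp: P_def)
        then have "E (p y) (p z)"
          by (rule E(3))
        then have "d y z \<le> real (f m)"
          using O(3)[of "p y" "p z"] dist_p(2)[of y z] y z f[of m] by (auto simp: P_def)
        then show "ennreal (d y z) \<le> of_nat (f m)"
          by (simp add: ennreal_of_nat_eq_real_of_nat ennreal_leI)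
      qed
      have "D n \<subseteq> {y\<in>?X. p y \<in> F}"
      proof
        fix y assume "y \<in> D n"
        then obtain k where "k < n" "y \<in> V k"
          by (auto simp: D_def)
        then show "y \<in> {y\<in>?X. p y \<in> F}"
          using idx_le[of y k] V(2) by (auto simp: F_def p_def)
      qed
      then have "measure \<mu> (D n) \<le> sum w F"
        using sum_w[OF F(1)] p_sets[of F] \<mu>(1) by (simp add: \<mu>.finite_measure_mono)
      then have "(1 - \<epsilon>) * ((1 - \<epsilon>) * measure \<mu> ?X) \<le> (1 - \<epsilon>) * sum w F"
        using n \<epsilon>(2) by (intro mult_left_mono) auto
      also have "\<dots> \<le> measure \<mu> (\<Union>i\<in>rep ` \<Omega>. P i)"
        unfolding Union using O(5) sum_w[of \<Omega>] finite_subset[OF O(1) F(1)] by simp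
      finally have "(1 - \<epsilon>) * (1 - \<epsilon>) * measure \<mu> ?X \<le> measure \<mu> (\<Union>i\<in>rep ` \<Omega>. P i)"
        by (simp add: mult.assoc)
      moreover have "c \<le> (1 - \<epsilon>) * (1 - \<epsilon>)"
        by (simp add: \<epsilon>(3) algebra_simps)
      then have "c * measure \<mu> ?X \<le> (1 - \<epsilon>) * (1 - \<epsilon>) * measure \<mu> ?X"
        by (rule mult_right_mono) simp
      ultimately show "c * measure \<mu> (space \<mu>) \<le> measure \<mu> (\<Union>i\<in>rep ` \<Omega>. P i)"
        unfolding space by linarith
    qed
  qed
  then show ?thesis
    unfolding metric_sparsification_def using c \<open>mono f\<close> by (intro conjI exI[of _ f]) auto
qed

section \<open>Covering the group by translates of one neighbourhood\<close>

lemma (in locally_compact_group) openin_left_translate: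
  assumes "openin T U" "g \<in> carrier G"
  shows "openin T {x\<in>carrier G. inv g \<otimes> x \<in> U}"
proof -
  have "continuous_map T (prod_topology T T) (\<lambda>x. (inv g, x))"
    using assms(2) topspace_eq_carrier by (intro continuous_map_pairedI) auto
  then have "continuous_map T T ((\<lambda>(x, y). x \<otimes> y) \<circ> (\<lambda>x. (inv g, x)))"
    using continuous_mult by (rule continuous_map_compose)
  then have "continuous_map T T (\<lambda>x. inv g \<otimes> x)"
    by (simp add: o_def)
  from openin_continuous_map_preimage[OF this assms(1)] show ?thesis
    by (simp add: topspace_eq_carrier)
qed

text \<open>A neighbourhood \<open>U\<close> of the identity inside a compact set is
  \<open>d\<close>-bounded by local finiteness. Its translates \<open>V g\<close> serve twice:
  finitely many cover any ball, which gives the coarse covering axiom, and countably many cover the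
  group, which allows measures to be discretised.\<close>

theorem theorem3p9:
  fixes G :: "('a, 'b) monoid_scheme" and T :: "'a topology" and d :: "'a \<Rightarrow> 'a \<Rightarrow> real"
  assumes "locally_compact_group G T"
    and "solvable G"
    and "Metric_space (carrier G) d"
    and "proper_metric T d"
    and "locally_finite_metric T d"
    and "left_invariant G d"
  shows "sparsification_number T d = 1"
proof -
  interpret locally_compact_group G T by fact
  interpret Metric_space "carrier G" d by fact
  obtain U K where U: "openin T U" "compactin T K" "\<one>\<^bsub>G\<^esub> \<in> U" "U \<subseteq> K"
    using locally_compact topspace_eq_carrier unfolding locally_compact_space_def by (metis one_closed)
  have inv: "d (g \<otimes>\<^bsub>G\<^esub> x) (g \<otimes>\<^bsub>G\<^esub> y) = d x y"
    if "g \<in> carrier G" "x \<in> carrier G" "y \<in> carrier G" for g x y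
    using that assms(6) by (simp add: left_invariant_def)
  define r where "r = enn2real (set_diameter d K)"
  have r: "d \<one>\<^bsub>G\<^esub> x \<le> r" if "x \<in> U" for x
  proof -
    have "set_diameter d K < \<infinity>"
      using assms(5) U(2) by (simp add: locally_finite_metric_def)
    moreover have "ennreal (d \<one>\<^bsub>G\<^esub> x) \<le> set_diameter d K"
      unfolding set_diameter_def using U that by (blast intro: SUP_upper2)
    ultimately show ?thesis
      unfolding r_def using enn2real_mono[of "ennreal (d \<one>\<^bsub>G\<^esub> x)" "set_diameter d K"] by simp
  qed
  define V where "V g = {x\<in>carrier G. inv\<^bsub>G\<^esub> g \<otimes>\<^bsub>G\<^esub> x \<in> U}" for g
  have V_near: "d g x \<le> r" if "g \<in> carrier G" "x \<in> V g" for g x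
    using that inv[of "inv\<^bsub>G\<^esub> g" g x] r[of "inv\<^bsub>G\<^esub> g \<otimes>\<^bsub>G\<^esub> x"] by (simp add: V_def)
  have V_open: "openin T (V g)" if "g \<in> carrier G" for g
    unfolding V_def using U(1) that by (rule openin_left_translate)
  have V_cover: "\<exists>S. finite S \<and> S \<subseteq> carrier G \<and> (\<forall>x\<in>carrier G. d \<one>\<^bsub>G\<^esub> x \<le> R \<longrightarrow> (\<exists>s\<in>S. x \<in> V s))" for R
  proof -
    \<comment> \<open>The extra 1 puts the closed ball of radius \<open>R\<close> inside the open
      ball, whose closure in \<open>T\<close> is compact by properness.\<close>
    let ?B = "mball \<one>\<^bsub>G\<^esub> (R + 1)"
    have "compactin T (T closure_of ?B)"
      using assms(4) by (simp add: proper_metric_def topspace_eq_carrier)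
    moreover have "T closure_of ?B \<subseteq> \<Union> (V ` carrier G)"
      using closure_of_subset_topspace[of T ?B] U(3) by (force simp: V_def topspace_eq_carrier)
    ultimately obtain \<F> where "finite \<F>" "\<F> \<subseteq> V ` carrier G" "T closure_of ?B \<subseteq> \<Union>\<F>"
      using compactinD[of T "T closure_of ?B" "V ` carrier G"] V_open by blast
    then obtain S where S: "finite S" "S \<subseteq> carrier G" "T closure_of ?B \<subseteq> \<Union> (V ` S)"
      by (metis finite_subset_image)
    have "?B \<subseteq> T closure_of ?B"
      by (rule closure_of_subset) (auto simp: topspace_eq_carrier)
    then have "\<exists>s\<in>S. x \<in> V s" if "x \<in> carrier G" "d \<one>\<^bsub>G\<^esub> x \<le> R" for x
      using that S(3) by force
    then show ?thesis
      using S(1,2) by blast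
  qed
  interpret coarsely_proper_group G d r
  proof
    show "\<exists>S. finite S \<and> S \<subseteq> carrier G \<and> (\<forall>x\<in>carrier G. d \<one>\<^bsub>G\<^esub> x \<le> R \<longrightarrow> (\<exists>s\<in>S. d s x \<le> r))" for R
      using V_cover[of R] V_near by (meson subsetD)
  qed (rule inv)
  have sp: "sparsifiable d (topspace T)"
    using assms(2) sparsifiable_solvable by (simp add: solvable_def topspace_eq_carrier)
  have "\<forall>n::nat. \<exists>S. finite S \<and> S \<subseteq> carrier G \<and>
      (\<forall>x\<in>carrier G. d \<one>\<^bsub>G\<^esub> x \<le> real n \<longrightarrow> (\<exists>s\<in>S. x \<in> V s))"
    by (intro allI V_cover)
  then obtain S where S: "\<And>n::nat. finite (S n)" "\<And>n. S n \<subseteq> carrier G"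
    "\<And>n x. x \<in> carrier G \<Longrightarrow> d \<one>\<^bsub>G\<^esub> x \<le> real n \<Longrightarrow> \<exists>s\<in>S n. x \<in> V s"
    by metis
  have S_cover: "\<exists>s\<in>(\<Union>n. S n). x \<in> V s" if "x \<in> carrier G" for x
    using S(3)[OF that real_nat_ceiling_ge] by blast
  define xs where "xs = from_nat_into (\<Union>n. S n)"
  have "(\<Union>n. S n) \<noteq> {}"
    using S_cover[OF one_closed] by blast
  then have range: "range xs = (\<Union>n. S n)"
    unfolding xs_def using S(1) by (intro range_from_nat_into) (auto intro: countable_finite)
  then have xs: "xs n \<in> carrier G" for n
    using S(2) by blast
  have "\<exists>n. x \<in> V (xs n)" if x: "x \<in> carrier G" for x
  proof -
    obtain s where "s \<in> range xs" "x \<in> V s"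
      using S_cover[OF x] unfolding range by blast
    then show ?thesis
      by blast
  qed
  then have "topspace T = (\<Union>n. V (xs n))"
    by (auto simp: V_def topspace_eq_carrier)
  then have MS: "metric_sparsification T d c" if "0 < c" "c < 1" for c
    using assms(3) xs V_open V_near sp that
    by (intro metric_sparsification_if_sparsifiable[where x = xs and V = "\<lambda>n. V (xs n)" and r = r])
      (auto simp: topspace_eq_carrier)
  \<comment> \<open>Every \<open>c\<close> strictly between 0 and 1 is admissible and none above 1
    is, so the supremum is 1 whether or not it is attained.\<close>
  have "Sup {c. metric_sparsification T d c} = 1"
  proof (rule cSup_eq)
    show "c \<le> 1" if "c \<in> {c. metric_sparsification T d c}" for c
      using that by (simp add: metric_sparsification_def)
    show "1 \<le> y" if "\<And>c. c \<in> {c. metric_sparsification T d c} \<Longrightarrow> c \<le> y" for y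
    proof (rule dense_le_bounded[of 0])
      show "c \<le> y" if "0 < c" "c < 1" for c
        using MS[OF that] \<open>\<And>c. c \<in> {c. metric_sparsification T d c} \<Longrightarrow> c \<le> y\<close> by simp
    qed simp
  qed
  \<comment> \<open>A witness for the first branch in \<open>sparsification_number\<close>.\<close>
  moreover have "metric_sparsification T d (1 / 2)"
    by (rule MS) auto
  ultimately show ?thesis
    unfolding sparsification_number_def by auto
qed

end
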